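(* Let $K$ be a field and let $A$ be a finite subset of the multiplicative group $K^{*}=K\setminus\{0\}$, with $|A|=n$. Let $A\dot\times A=\{xy : x,y\in A,\ x\neq y\}$. Assume that some element $c\in A\dot\times A$ has exactly two (symmetric to each other) representations $c=ab=ba$ with $a,b\in A$, $a\neq b$ (that is, the only ordered pairs $(x,y)\in A\times A$ with $x\neq y$ and $xy=c$ are $(a,b)$ and $(b,a)$). Assume also that $a^{n-2}\neq b^{n-2}$. Then $|A\dot\times A|\geq 2n-3$.
   Context: For a finite subset $A$ of a multiplicatively written abelian group, the restricted product set is $A\dot\times A=\{xy : x,y\in A,\ x\neq y\}$. Only representations $c=xy$ with $x\neq y$ are counted; $c$ may additionally be of the form $d^2$ with $d\in A$. *)

theory Defs
  imports Main
begin

definition restricted_product_set :: "'a::ab_semigroup_mult set \<Rightarrow> 'a set" where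
  "restricted_product_set A = {x * y | x y. x \<in> A \<and> y \<in> A \<and> x \<noteq> y}"

text \<open>Ordered representations with distinct factors; \<open>c = d * d\<close> is not counted.\<close>

definition restricted_representations :: "'a::ab_semigroup_mult set \<Rightarrow> 'a \<Rightarrow> ('a \<times> 'a) set" where
  "restricted_representations A c = {(x, y). x \<in> A \<and> y \<in> A \<and> x \<noteq> y \<and> x * y = c}"

end

theory Submission
  imports Defs "HOL-Computational_Algebra.Polynomial"
begin

text \<open>
  The proof is a form of the polynomial method of Alon, Nathanson and Ruzsa. Put \<open>n = card A\<close> and
  replace the second factor of a product by its inverse: with \<open>z = 1 / y\<close>, the condition \<open>x * y = d\<close>
  becomes the linear condition \<open>x = d * z\<close>, and \<open>x = y\<close> becomes \<open>x * z = 1\<close>. If \<open>C\<close> is the restricted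
  product set, the polynomial
    \<open>F(x, z) = x ^ i * (x * z - 1) * (\<Prod>d\<in>C - {c}. x - d * z)\<close>
  vanishes on the whole grid \<open>A \<times> inverse ` A\<close> except at the two points that come from the
  representations of \<open>c\<close>.

  Suppose that \<open>C\<close> had fewer than \<open>2 * n - 3\<close> elements. Then \<open>i\<close> can be chosen so that \<open>F\<close> has degree
  exactly \<open>2 * n - 3\<close>, one less than the degree of \<open>x ^ (n - 1) * z ^ (n - 1)\<close>. The coefficient
  formula behind the Combinatorial Nullstellensatz expresses the coefficient of this monomial, here
  zero, as the sum of the values of \<open>F\<close> on the grid with Lagrange weights (\<open>grid_sum_vanishes\<close>). So
  the two surviving terms cancel. The weights on \<open>inverse ` A\<close> can be written with those on \<open>A\<close>
  (\<open>node_product_inverse\<close>), which makes the weights and the product over \<open>C - {c}\<close> contribute the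
  same nonzero constant to both terms, up to powers of \<open>a\<close> and \<open>b\<close>. The factor
  \<open>x * z - 1 = (x - y) / y\<close> supplies the opposite signs, so comparing the powers leaves
  \<open>a ^ (n - 2) = b ^ (n - 2)\<close>, which is excluded.
\<close>

text \<open>
  For \<open>x \<in> A\<close> this is the value at \<open>x\<close> of the derivative of \<open>\<Prod>u\<in>A. X - u\<close>, the reciprocal of the
  Lagrange weight of the node \<open>x\<close>.
\<close>

definition node_product :: "'k::field set \<Rightarrow> 'k \<Rightarrow> 'k" where
  "node_product A x = (\<Prod>u\<in>A - {x}. x - u)"

lemma node_product_nonzero: "finite A \<Longrightarrow> node_product A x \<noteq> 0"
  unfolding node_product_def by auto

text \<open>
  Lagrange interpolation of \<open>X ^ k\<close> at the nodes of \<open>A\<close> reproduces \<open>X ^ k\<close>; the sum is the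
  coefficient of \<open>X ^ (card A - 1)\<close> in the interpolant, and \<open>k\<close> is smaller than this exponent.
\<close>

lemma sum_power_over_node_product:
  fixes A :: "'k::field set"
  assumes fin: "finite A" and k: "Suc k < card A"
  shows "(\<Sum>x\<in>A. x ^ k / node_product A x) = 0"
proof -
  define l :: "'k \<Rightarrow> 'k poly" where "l x = (\<Prod>u\<in>A - {x}. [:- u, 1:])" for x
  define q where "q = (\<Sum>x\<in>A. smult (x ^ k / node_product A x) (l x))"
  have deg_l: "degree (l x) = card A - 1" if "x \<in> A" for x
    using that fin by (simp add: l_def degree_prod_sum_eq card_Diff_singleton)
  have top_l: "coeff (l x) (card A - 1) = 1" if "x \<in> A" for x
    using lead_coeff_prod[of "\<lambda>u. [:- u, 1:]" "A - {x}"] deg_l[OF that] by (simp add: l_def)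
  have poly_l: "poly (l x) y = (if y = x then node_product A x else 0)"
    if "x \<in> A" "y \<in> A" for x y
    using that fin by (auto simp: l_def poly_prod node_product_def)
  have "q = monom 1 k"
  proof (rule poly_eqI_degree[of A])
    fix y assume y: "y \<in> A"
    have "poly q y = (\<Sum>x\<in>A. if x = y then y ^ k else 0)"
      unfolding q_def poly_sum using y poly_l fin
      by (intro sum.cong) (auto simp: node_product_nonzero)
    then show "poly q y = poly (monom 1 k) y"
      using y fin by (simp add: poly_monom)
  next
    have "degree q \<le> card A - 1"
      unfolding q_def
      by (intro degree_sum_le[OF fin] order_trans[OF degree_smult_le]) (simp add: deg_l)
    then show "card A > degree q" using k by linarith
    show "card A > degree (monom (1::'k) k)" using k by (simp add: degree_monom_eq)
  qed
  then have "coeff q (card A - 1) = 0" using k by simp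
  moreover have "coeff q (card A - 1) = (\<Sum>x\<in>A. x ^ k / node_product A x)"
    unfolding q_def coeff_sum by (intro sum.cong refl) (simp del: One_nat_def add: top_l)
  ultimately show ?thesis by simp
qed

text \<open>
  Expanded in monomials, the summand has total degree below \<open>(card A - 1) + (card B - 1)\<close>, so in each
  monomial one of the variables has an exponent to which \<open>sum_power_over_node_product\<close> applies. The
  arbitrary exponents \<open>p\<close> and \<open>q\<close> permit an induction that splits off one linear factor at a time
  and so avoids bivariate polynomials.
\<close>

lemma grid_sum_vanishes:
  fixes A B D :: "'k::field set"
  assumes fin: "finite A" "finite B" "finite D"
    and deg: "p + q + card D + 2 < card A + card B"
  shows "(\<Sum>x\<in>A. \<Sum>z\<in>B. x ^ p * z ^ q * (\<Prod>d\<in>D. x - d * z)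
            / (node_product A x * node_product B z)) = 0"
  using \<open>finite D\<close> deg
proof (induction D arbitrary: p q rule: finite_induct)
  case empty
  have "(\<Sum>x\<in>A. \<Sum>z\<in>B. x ^ p * z ^ q / (node_product A x * node_product B z))
      = (\<Sum>x\<in>A. x ^ p / node_product A x) * (\<Sum>z\<in>B. z ^ q / node_product B z)"
    by (simp add: sum_product)
  moreover have "Suc p < card A \<or> Suc q < card B" using empty by auto
  ultimately show ?case
    using sum_power_over_node_product fin by auto
next
  case (insert e D)
  let ?S = "\<lambda>p q. \<Sum>x\<in>A. \<Sum>z\<in>B. x ^ p * z ^ q * (\<Prod>d\<in>D. x - d * z)
            / (node_product A x * node_product B z)"
  have "(\<Sum>x\<in>A. \<Sum>z\<in>B. x ^ p * z ^ q * (\<Prod>d\<in>insert e D. x - d * z)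
            / (node_product A x * node_product B z)) = ?S (Suc p) q - e * ?S p (Suc q)"
    unfolding sum_distrib_left sum_subtractf[symmetric] using insert.hyps
    by (intro sum.cong refl) (simp add: diff_divide_distrib algebra_simps)
  also have "\<dots> = 0"
    using insert.IH[of "Suc p" q] insert.IH[of p "Suc q"] insert.hyps insert.prems
    by (simp del: power_Suc)
  finally show ?case .
qed

text \<open>
  Each factor is \<open>1 / y - 1 / u = - (y - u) / (y * u)\<close>. Apart from the power of \<open>y\<close>, the conversion
  factor is the same for all nodes.
\<close>

lemma node_product_inverse:
  fixes A :: "'k::field set"
  assumes fin: "finite A" and nz: "0 \<notin> A" and y: "y \<in> A" and n: "2 \<le> card A"
  shows "node_product (inverse ` A) (inverse y)
       = (- 1) ^ (card A - 1) * node_product A y / (y ^ (card A - 2) * \<Prod>A)"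
proof -
  have "inverse ` A - {inverse y} = inverse ` (A - {y})" by auto
  then have "node_product (inverse ` A) (inverse y) = (\<Prod>u\<in>A - {y}. inverse y - inverse u)"
    unfolding node_product_def by (simp add: prod.reindex inj_on_def)
  also have "\<dots> = (\<Prod>u\<in>A - {y}. (- 1) * (y - u) / (y * u))"
  proof (rule prod.cong[OF refl])
    fix u assume "u \<in> A - {y}"
    then have "u \<noteq> 0" "y \<noteq> 0" using nz y by auto
    then show "inverse y - inverse u = (- 1) * (y - u) / (y * u)" by (simp add: field_simps)
  qed
  also have "\<dots> = (- 1) ^ (card A - 1) * node_product A y / (y ^ (card A - 1) * \<Prod>(A - {y}))"
    using fin y unfolding prod_dividef prod.distrib node_product_def by simp
  also have "y ^ (card A - 1) * \<Prod>(A - {y}) = y ^ (card A - 2) * \<Prod>A"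
  proof -
    have "\<Prod>A = y * \<Prod>(A - {y})" using fin y by (rule prod.remove)
    moreover have "card A - 1 = Suc (card A - 2)" using n by simp
    ultimately show ?thesis by simp
  qed
  finally show ?thesis .
qed

theorem theorem7:
  fixes A :: "'k::field set" and a b c :: 'k and n :: nat
  assumes "finite A"
    and "A \<subseteq> UNIV - {0}"
    and "card A = n"
    and "c \<in> restricted_product_set A"
    and "a \<in> A" and "b \<in> A" and "a \<noteq> b"
    and "restricted_representations A c = {(a, b), (b, a)}"
    and "a ^ (n - 2) \<noteq> b ^ (n - 2)"
  shows "card (restricted_product_set A) \<ge> 2 * n - 3"
proof (rule ccontr)
  let ?C = "restricted_product_set A"
  define D where "D = ?C - {c}"
  define m where "m = card D"
  assume "\<not> 2 * n - 3 \<le> card ?C"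
  then have small: "card ?C < 2 * n - 3" by simp
  note fin = \<open>finite A\<close>
  have nz: "0 \<notin> A" using assms(2) by auto
  have "?C \<subseteq> (\<lambda>(x, y). x * y) ` (A \<times> A)"
    by (auto simp: restricted_product_set_def)
  then have finC: "finite ?C" using fin finite_subset by blast
  have n3: "3 \<le> n" using assms(9) by (cases "n \<le> 2") auto
  have "card ?C = Suc m"
    unfolding m_def D_def using finC assms(4) by (rule card.remove)
  with small have m: "m + 5 \<le> 2 * n" by linarith
  \<comment> \<open>The padding \<open>x ^ i\<close> fixes the total degree \<open>i + 2 + m = 2 * n - 3\<close>; the final comparison of
    powers needs exactly this value, independently of \<open>m\<close>.\<close>
  define i where "i = 2 * n - 5 - m"
  have finD: "finite D" using finC by (simp add: D_def)

  let ?f = "node_product A" and ?g = "node_product (inverse ` A)"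
  have cardB: "card (inverse ` A) = n"
    using assms(3) by (simp add: card_image inj_on_def)
  let ?S = "\<lambda>p q. \<Sum>x\<in>A. \<Sum>z\<in>inverse ` A. x ^ p * z ^ q * (\<Prod>d\<in>D. x - d * z) / (?f x * ?g z)"
  define T where
    "T x y = x ^ i * (x / y - 1) * (\<Prod>d\<in>D. x - d / y) / (?f x * ?g (inverse y))" for x y
  \<comment> \<open>The factor \<open>x * z - 1\<close> is not of the form treated in \<open>grid_sum_vanishes\<close>, but splitting it
    gives two sums that are.\<close>
  have "(\<Sum>x\<in>A. \<Sum>y\<in>A. T x y) = ?S (Suc i) 1 - ?S i 0"
    unfolding T_def sum_subtractf[symmetric]
    by (simp add: sum.reindex inj_on_def divide_inverse algebra_simps)
  also have "\<dots> = 0"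
  proof -
    have "?S (Suc i) 1 = 0" "?S i 0 = 0"
      using fin finD m n3 assms(3) cardB
      by (intro grid_sum_vanishes; simp add: i_def m_def[symmetric])+
    then show ?thesis by simp
  qed
  finally have zero: "(\<Sum>x\<in>A. \<Sum>y\<in>A. T x y) = 0" .

  have T0: "T x y = 0" if xy: "x \<in> A" "y \<in> A" "(x, y) \<notin> {(a, b), (b, a)}" for x y
  proof (cases "x = y")
    case True
    then show ?thesis using xy nz by (auto simp: T_def)
  next
    case False
    then have "x * y \<noteq> c"
      using xy assms(8) by (auto simp: restricted_representations_def)
    with False xy have "x * y \<in> D"
      by (auto simp: D_def restricted_product_set_def)
    moreover have "x - x * y / y = 0" using xy nz by auto
    ultimately have "(\<Prod>d\<in>D. x - d / y) = 0"
      using finD by (intro prod_zero bexI[of _ "x * y"])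
    then show ?thesis by (simp add: T_def)
  qed
  have "(\<Sum>x\<in>A. \<Sum>y\<in>A. T x y) = (\<Sum>(x, y)\<in>A \<times> A. T x y)"
    by (simp add: sum.cartesian_product)
  also have "\<dots> = (\<Sum>(x, y)\<in>{(a, b), (b, a)}. T x y)"
    using fin assms(5,6) T0 by (intro sum.mono_neutral_right) auto
  also have "\<dots> = T a b + T b a"
    using \<open>a \<noteq> b\<close> by simp
  finally have two: "T a b + T b a = 0" using zero by simp

  \<comment> \<open>\<open>\<kappa>\<close> collects what the two surviving terms share: the product over \<open>D\<close> depends on \<open>x\<close> and \<open>y\<close> only
    through \<open>x * y = c\<close> and a power of \<open>y\<close>, and the weights are symmetric up to a power of \<open>y\<close>.\<close>
  define E where "E = (\<Prod>d\<in>D. c - d)"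
  define \<kappa> where "\<kappa> = E * \<Prod>A / ((- 1) ^ (n - 1) * ?f a * ?f b)"
  have "E \<noteq> 0" using finD by (auto simp: E_def D_def)
  moreover have "\<Prod>A \<noteq> 0" using fin nz by auto
  ultimately have \<kappa>: "\<kappa> \<noteq> 0"
    using fin by (simp add: \<kappa>_def node_product_nonzero)
  have T_eq: "T x y = (x - y) * \<kappa> * (x ^ i * y ^ (n - 2) / y ^ Suc m)"
    if "(x, y) \<in> {(a, b), (b, a)}" for x y
  proof -
    have "(x, y) \<in> restricted_representations A c" using that assms(8) by blast
    then have xy: "x \<in> A" "y \<in> A" "x * y = c"
      by (simp_all add: restricted_representations_def)
    have y0: "y \<noteq> 0" using xy nz by auto
    have "(\<Prod>d\<in>D. x - d / y) = (\<Prod>d\<in>D. (c - d) / y)"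
      using y0 by (simp add: xy(3)[symmetric] diff_divide_distrib)
    then have P: "(\<Prod>d\<in>D. x - d / y) = E / y ^ m"
      by (simp add: prod_dividef E_def m_def)
    have g: "?g (inverse y) = (- 1) ^ (n - 1) * ?f y / (y ^ (n - 2) * \<Prod>A)"
      using node_product_inverse[OF fin nz xy(2)] n3 assms(3) by simp
    have f: "?f x * ?f y = ?f a * ?f b" using that by auto
    have "T x y = x ^ i * ((x - y) / y) * (E / y ^ m) * (y ^ (n - 2) * \<Prod>A)
        / ((- 1) ^ (n - 1) * (?f x * ?f y))"
      unfolding T_def P g using y0 by (simp add: diff_divide_distrib)
    then show ?thesis unfolding f \<kappa>_def by (simp add: mult_ac)
  qed
  have ab0: "a \<noteq> 0" "b \<noteq> 0" using assms(5,6) nz by auto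
  define p where "p = a ^ i * b ^ (n - 2) / b ^ Suc m"
  define q where "q = b ^ i * a ^ (n - 2) / a ^ Suc m"
  have "T a b = (a - b) * \<kappa> * p" "T b a = (b - a) * \<kappa> * q"
    unfolding p_def q_def by (rule T_eq, simp)+
  with two have "(a - b) * \<kappa> * (p - q) = 0" by (simp add: algebra_simps)
  then have "p = q" using \<kappa> \<open>a \<noteq> b\<close> by simp
  then have powers: "a ^ (i + Suc m) * b ^ (n - 2) = b ^ (i + Suc m) * a ^ (n - 2)"
    using ab0 unfolding p_def q_def by (simp add: frac_eq_eq power_add mult_ac)
  have exponent: "i + Suc m = (n - 2) + (n - 2)" using m n3 by (simp add: i_def)
  have "(a ^ (n - 2) * b ^ (n - 2)) * a ^ (n - 2) = (a ^ (n - 2) * b ^ (n - 2)) * b ^ (n - 2)"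
    using powers unfolding exponent power_add by (simp only: mult_ac)
  then have "a ^ (n - 2) = b ^ (n - 2)"
    using ab0 by simp
  then show False using assms(9) by simp
qed

end
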